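(* Let $f(z)\in\mathbb C[z]$ be a self-inversive polynomial of degree $n\ge 2$, let $f_*$ be its homogenization, and let $M=\begin{bmatrix} 1 & -i\\ 1 & i\end{bmatrix}$. Then the following are equivalent: (i) all roots of $f(z)$ are on the unit circle $\{z\in\mathbb C: |z|=1\}$; (ii) all roots of the derivative $f'(z)$ are in the closed unit disk $\{z\in\mathbb C: |z|\le 1\}$; (iii) $f_*^M$ is a totally real form.
   Context: A polynomial $p(z)=\sum_{i=0}^n a_i z^i\in\mathbb C[z]$ of degree $n$ is self-inversive if its set of zeros (counted with multiplicity) is fixed by the inversion map $z\mapsto 1/\bar z$; equivalently, there is $w\in\mathbb C$ with $|w|=1$ such that $p(z)=w\, z^n\,\bar p(1/z)$ for all $z\neq 0$, where $\bar p(z)=\sum_{i=0}^n \bar a_i z^i$. The homogenization of $f(z)=\sum_{i=0}^n a_i z^i$ (degree $n$) is the binary form $f_*(z,y)=\sum_{i=0}^n a_i z^i y^{n-i}$. For $M=\begin{bmatrix} a&b\\c&d\end{bmatrix}\in GL_2(\mathbb C)$, the form $f_*^M$ is given by the linear change of variables $f_*^M(z,y)=f_*(az+by,\,cz+dy)$. A binary form is totally real if it splits over $\mathbb R$, i.e. it is, up to a nonzero constant factor, a product of linear forms with real coefficients. *)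

theory Defs
  imports "HOL-Analysis.Analysis" "HOL-Computational_Algebra.Fundamental_Theorem_Algebra"
begin

text \<open>
  The inversion \<open>z \<mapsto> 1 / cnj z\<close> exchanges 0 and infinity. A polynomial of degree \<open>n\<close> does not have
  infinity among its \<open>n\<close> zeros, so if its zeros are fixed by inversion, 0 is not one of them.
  As \<open>1 / 0 = 0\<close> in HOL, this has to be required explicitly.
\<close>
definition self_inversive :: "complex poly \<Rightarrow> bool" where
  "self_inversive p \<longleftrightarrow>
     p \<noteq> 0 \<and> poly p 0 \<noteq> 0 \<and> image_mset (\<lambda>z. 1 / cnj z) (proots p) = proots p"

text \<open>
  Bivariate polynomials in \<open>z\<close> and \<open>y\<close> over the complex numbers are elements of \<open>\<complex>[y][z]\<close>: the outer
  indeterminate is \<open>z\<close>, the inner one is \<open>y\<close>.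
\<close>
definition Cst :: "complex \<Rightarrow> complex poly poly" where
  "Cst c = [:[:c:]:]"

definition Z :: "complex poly poly" where
  "Z = [:0, 1:]"

definition Y :: "complex poly poly" where
  "Y = [:[:0, 1:]:]"

definition eval2 :: "complex poly poly \<Rightarrow> complex \<Rightarrow> complex \<Rightarrow> complex" where
  "eval2 F z y = poly (poly F [:z:]) y"

definition homogenization :: "complex poly \<Rightarrow> complex poly poly" where
  "homogenization f = (\<Sum>i\<le>degree f. Cst (coeff f i) * Z ^ i * Y ^ (degree f - i))"

definition change_vars :: "complex poly poly \<Rightarrow> complex^2^2 \<Rightarrow> complex poly poly" where
  "change_vars F M =
     (\<Sum>i\<le>degree F. \<Sum>j\<le>degree (coeff F i).
        Cst (coeff (coeff F i) j)
          * (Cst (M $ 1 $ 1) * Z + Cst (M $ 1 $ 2) * Y) ^ i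
          * (Cst (M $ 2 $ 1) * Z + Cst (M $ 2 $ 2) * Y) ^ j)"

definition totally_real :: "complex poly poly \<Rightarrow> bool" where
  "totally_real F \<longleftrightarrow>
     (\<exists>(c::complex) (ls :: (real \<times> real) list).
        c \<noteq> 0 \<and> (0, 0) \<notin> set ls \<and>
        F = Cst c * (\<Prod>(a, b)\<leftarrow>ls. Cst (of_real a) * Z + Cst (of_real b) * Y))"

lemma eval2_simps [simp]:
  "eval2 (Cst c) z y = c" "eval2 Z z y = z" "eval2 Y z y = y"
  "eval2 (F + G) z y = eval2 F z y + eval2 G z y"
  "eval2 (F * G) z y = eval2 F z y * eval2 G z y"
  "eval2 (F ^ k) z y = eval2 F z y ^ k"
  "eval2 (sum h A) z y = (\<Sum>x\<in>A. eval2 (h x) z y)"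
  by (simp_all add: eval2_def Cst_def Z_def Y_def poly_sum)

lemma eval2_homogenization:
  "eval2 (homogenization f) z y = (\<Sum>i\<le>degree f. coeff f i * z ^ i * y ^ (degree f - i))"
  by (simp add: homogenization_def)

lemma eval2_change_vars:
  "eval2 (change_vars F M) z y =
     eval2 F (M $ 1 $ 1 * z + M $ 1 $ 2 * y) (M $ 2 $ 1 * z + M $ 2 $ 2 * y)"
proof -
  have "eval2 F u v = (\<Sum>i\<le>degree F. \<Sum>j\<le>degree (coeff F i). coeff (coeff F i) j * u ^ i * v ^ j)"
    for u v
  proof -
    have "eval2 F u v = (\<Sum>i\<le>degree F. poly (coeff F i) v * u ^ i)"
      unfolding eval2_def poly_altdef [of F] by (simp add: poly_sum)
    then show ?thesis
      by (simp add: poly_altdef [of "coeff F _"] sum_distrib_left sum_distrib_right mult_ac)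
  qed
  then show ?thesis
    by (simp add: change_vars_def)
qed

lemma eval2_eqI:
  assumes "\<And>z y. eval2 F z y = eval2 G z y"
  shows "F = G"
proof (rule ccontr)
  assume "F \<noteq> G"
  then have "finite {x. poly (F - G) x = 0}"
    by (intro poly_roots_finite) simp
  moreover have "range (\<lambda>z::complex. [:z:]) \<subseteq> {x. poly (F - G) x = 0}"
  proof clarify
    fix z :: complex
    have "poly (poly F [:z:]) = poly (poly G [:z:])"
      using assms by (auto simp: eval2_def)
    then show "poly (F - G) [:z:] = 0"
      by (simp add: poly_eq_poly_eq_iff)
  qed
  ultimately have "finite (range (\<lambda>z::complex. [:z:]))"
    using finite_subset by blast
  moreover have "inj (\<lambda>z::complex. [:z:])"
    by (simp add: inj_def)
  ultimately show False
    using finite_imageD infinite_UNIV_char_0 by blast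
qed

lemma map_poly_cnj_mult: "map_poly cnj (p * q) = map_poly cnj p * map_poly cnj q"
  by (rule poly_eqI) (simp add: coeff_map_poly coeff_mult)

lemma proots_reflect_cnj:
  assumes "p \<noteq> 0" "poly p 0 \<noteq> 0"
  shows "proots (reflect_poly (map_poly cnj p)) = image_mset (\<lambda>z. 1 / cnj z) (proots p)"
proof -
  let ?R = "\<lambda>p. reflect_poly (map_poly cnj p)"
  have *: "?R (\<Prod>r\<in>#A. [:-r, 1:]) \<noteq> 0 \<and>
      proots (?R (\<Prod>r\<in>#A. [:-r, 1:])) = image_mset (\<lambda>z. 1 / cnj z) A" if "0 \<notin># A" for A
    using that
  proof (induction A)
    case empty
    then show ?case by (simp add: map_poly_1)
  next
    case (add r A)
    have r: "r \<noteq> 0" using add.prems by auto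
    have "map_poly cnj [:-r, 1:] = [:- cnj r, 1:]"
      by (simp add: map_poly_pCons)
    then have "?R [:-r, 1:] = [:1, - cnj r:]"
      using r by (simp add: reflect_poly_def)
    also have "\<dots> = smult (- cnj r) [:- (1 / cnj r), 1:]"
      using r by simp
    finally have R: "?R [:-r, 1:] = smult (- cnj r) [:- (1 / cnj r), 1:]" .
    have "proots (?R [:-r, 1:]) = {#1 / cnj r#}"
      unfolding R using r by (subst proots_smult) (simp_all only: proots_linear_factor, auto)
    moreover have "?R [:-r, 1:] \<noteq> 0"
      unfolding R using r by simp
    ultimately show ?case
      using add by (simp add: map_poly_cnj_mult reflect_poly_mult proots_mult del: mult_pCons_left)
  qed
  have "0 \<notin># proots p" using assms by simp
  have "?R p = ?R (smult (lead_coeff p) (\<Prod>r\<in>#proots p. [:-r, 1:]))"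
    by (simp only: complex_poly_decompose_multiset)
  also have "\<dots> = smult (cnj (lead_coeff p)) (?R (\<Prod>r\<in>#proots p. [:-r, 1:]))"
    by (simp add: map_poly_smult reflect_poly_smult)
  finally show ?thesis
    using * [OF \<open>0 \<notin># proots p\<close>] assms by simp
qed

lemma self_inversive_iff:
  assumes "p \<noteq> 0"
  shows "self_inversive p \<longleftrightarrow>
    (\<exists>w. norm w = 1 \<and>
      (\<forall>z. z \<noteq> 0 \<longrightarrow> poly p z = w * z ^ degree p * poly (map_poly cnj p) (1 / z)))"
    (is "_ \<longleftrightarrow> (\<exists>w. norm w = 1 \<and> ?P w)")
proof -
  define q where "q = reflect_poly (map_poly cnj p)"
  have deg: "degree (map_poly cnj p) = degree p"
    by (simp add: degree_map_poly)
  have q0: "q \<noteq> 0" using assms by (simp add: q_def map_poly_eq_0_iff)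
  have q: "poly q z = z ^ degree p * poly (map_poly cnj p) (1 / z)" if "z \<noteq> 0" for z
    using poly_reflect_poly_nz [OF that, of "map_poly cnj p"]
    by (simp only: q_def deg inverse_eq_divide)
  have coeff_q: "coeff q 0 = cnj (lead_coeff p)"
    by (simp add: q_def coeff_map_poly deg)
  have P: "?P w \<longleftrightarrow> p = smult w q" for w
  proof
    assume L: "?P w"
    have "poly (p - smult w q) z = 0" if "z \<noteq> 0" for z
      using L [rule_format, OF that] by (simp only: poly_diff poly_smult q [OF that] mult.assoc diff_self)
    then have sub: "- {0} \<subseteq> {z. poly (p - smult w q) z = 0}"
      by blast
    show "p = smult w q"
    proof (rule ccontr)
      assume "p \<noteq> smult w q"
      then have "finite {z. poly (p - smult w q) z = 0}"
        by (intro poly_roots_finite) (simp only: right_minus_eq not_False_eq_True)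
      then have "finite (- {0 :: complex})"
        using sub by (rule rev_finite_subset)
      then show False
        by (simp add: infinite_UNIV_char_0)
    qed
  next
    assume "p = smult w q"
    then have "poly p z = w * poly q z" for z
      by simp
    then show "?P w"
      by (intro allI impI) (simp only: q mult.assoc not_False_eq_True)
  qed
  show ?thesis
    unfolding P
  proof
    assume s: "self_inversive p"
    then have "proots q = proots p"
      using proots_reflect_cnj by (simp add: self_inversive_def q_def)
    define r where "r = (\<Prod>x\<in>#proots p. [:-x, 1:])"
    have "p = smult (lead_coeff p) r"
      unfolding r_def by (rule complex_poly_decompose_multiset [symmetric])
    moreover have "q = smult (lead_coeff q) r"
      unfolding r_def \<open>proots q = proots p\<close> [symmetric]
      by (rule complex_poly_decompose_multiset [symmetric])
    ultimately have e: "smult (lead_coeff p) q = smult (lead_coeff q) p"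
      by (metis mult.commute smult_smult)
    define w where "w = lead_coeff p / lead_coeff q"
    have "p = smult w q"
    proof -
      have "p = smult (1 / lead_coeff q) (smult (lead_coeff q) p)"
        using q0 by (simp only: smult_smult leading_coeff_0_iff) simp
      also have "\<dots> = smult w q"
        unfolding e [symmetric] w_def by simp
      finally show ?thesis .
    qed
    moreover have "lead_coeff q = cnj (coeff p 0)"
      using s by (simp add: q_def self_inversive_def poly_0_coeff_0 coeff_map_poly
          coeff_reflect_poly deg)
    moreover have "norm (lead_coeff p) = norm (coeff p 0)"
    proof -
      have "coeff (smult (lead_coeff p) q) 0 = coeff (smult (lead_coeff q) p) 0"
        by (simp only: e)
      then have "lead_coeff p * cnj (lead_coeff p) = cnj (coeff p 0) * coeff p 0"
        by (simp only: coeff_smult coeff_q \<open>lead_coeff q = _\<close>)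
      then have "norm (lead_coeff p) ^ 2 = norm (coeff p 0) ^ 2"
        by (metis complex_mod_cnj mult.commute norm_mult power2_eq_square)
      then show ?thesis by simp
    qed
    ultimately show "\<exists>w. norm w = 1 \<and> p = smult w q"
      using q0 by (intro exI [of _ w]) (auto simp: w_def norm_divide)
  next
    assume "\<exists>w. norm w = 1 \<and> p = smult w q"
    then obtain w where w: "norm w = 1" "p = smult w q" by blast
    have "poly p 0 = w * cnj (lead_coeff p)"
      using arg_cong [OF w(2), of "\<lambda>p. coeff p 0"]
      by (simp only: poly_0_coeff_0 coeff_smult coeff_q)
    then have p0: "poly p 0 \<noteq> 0" using w(1) assms by auto
    have "proots p = proots q"
      using w(1) by (subst w(2), subst proots_smult) auto
    then show "self_inversive p"
      using p0 assms by (simp add: self_inversive_def q_def proots_reflect_cnj)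
  qed
qed

end

theory Submission
  imports Defs
begin

text \<open>
  The inversion \<open>z \<mapsto> 1 / cnj z\<close> pairs the zeros of a self-inversive polynomial \<open>f\<close> of degree \<open>n\<close>
  that lie outside the unit circle with those that lie inside.

  If all zeros lie on the circle, those of \<open>f'\<close> lie in the closed disk by Gauss and Lucas: at
  a point \<open>z\<close> outside the disk, \<open>z f'(z) / f(z)\<close> is the sum of the numbers \<open>z / (z - r)\<close> over the
  zeros \<open>r\<close> of \<open>f\<close>, whose real parts are positive (\<open>pderiv_nonzero_outside_disk\<close>).

  Conversely, differentiating \<open>f(z) = w z^n cnj (f (1 / cnj z))\<close> shows that \<open>n f(z)\<close> is the sum of
  \<open>z f'(z)\<close> and of \<open>w\<close> times the conjugate reversal of \<open>f'\<close> (\<open>self_inversive_pderiv\<close>). When the zeros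
  of \<open>f'\<close> lie in the closed disk, the quotient of this reversal by \<open>f'\<close> is, up to a unimodular
  constant, a product of reciprocals \<open>(1 - z * cnj r) / (z - r)\<close> of Blaschke factors, hence at most
  1 in modulus for \<open>norm z > 1\<close> (\<open>norm_conj_reversal_le\<close>). The first summand then strictly
  dominates the second one, so \<open>f\<close> has no zero outside the disk, and by the symmetry of the zeros
  none inside the circle.

  The substitution \<open>(z, y) \<mapsto> (z - \<i> y, z + \<i> y)\<close> is a Cayley transformation: it carries the real
  projective line to the unit circle. A linear form \<open>u - r v\<close> thus becomes a multiple of a real one
  exactly if \<open>r\<close> lies on the circle (\<open>cayley_linear_factor\<close>, \<open>norm_cayley_root\<close>). This gives the
  equivalence with total reality factor by factor, for every nonzero polynomial
  (\<open>totally_real_cayley_iff\<close>).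
\<close>

section \<open>Zeros of the derivative\<close>

lemma poly_eq_prod_proots:
  fixes f :: "complex poly"
  shows "poly f z = lead_coeff f * (\<Prod>r\<in>#proots f. z - r)"
proof -
  have "poly f z = poly (smult (lead_coeff f) (\<Prod>r\<in>#proots f. [:-r, 1:])) z"
    by (simp only: complex_poly_decompose_multiset)
  then show ?thesis
    by (simp add: poly_prod_mset)
qed

lemma poly_pderiv_prod_linear:
  fixes z :: complex
  assumes "\<forall>r\<in>#A. z \<noteq> r"
  shows "poly (pderiv (\<Prod>r\<in>#A. [:-r, 1:])) z
    = poly (\<Prod>r\<in>#A. [:-r, 1:]) z * (\<Sum>r\<in>#A. 1 / (z - r))"
  using assms
proof (induction A)
  case (add r A)
  then show ?case
    by (simp add: pderiv_mult pderiv_pCons field_simps del: mult_pCons_left)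
qed simp

lemma poly_pderiv_eq_sum_proots:
  fixes f :: "complex poly"
  assumes "poly f z \<noteq> 0"
  shows "poly (pderiv f) z = poly f z * (\<Sum>r\<in>#proots f. 1 / (z - r))"
proof -
  have "f \<noteq> 0" using assms by auto
  let ?p = "\<Prod>r\<in>#proots f. [:-r, 1:]"
  have f: "f = smult (lead_coeff f) ?p"
    by (rule complex_poly_decompose_multiset [symmetric])
  have "\<forall>r\<in>#proots f. z \<noteq> r"
    using assms \<open>f \<noteq> 0\<close> by auto
  then have "poly (pderiv ?p) z = poly ?p z * (\<Sum>r\<in>#proots f. 1 / (z - r))"
    by (rule poly_pderiv_prod_linear)
  moreover have "poly (pderiv f) z = lead_coeff f * poly (pderiv ?p) z"
    by (subst f) (simp only: pderiv_smult poly_smult)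
  moreover have "poly f z = lead_coeff f * poly ?p z"
    by (subst f) (simp only: poly_smult)
  ultimately show ?thesis by simp
qed

text \<open>
  The real part is \<open>norm z ^ 2 - Re (r * cnj z)\<close> divided by \<open>norm (z - r) ^ 2\<close>.
\<close>
lemma Re_divide_diff_pos:
  fixes z r :: complex
  assumes "norm r < norm z"
  shows "Re (z / (z - r)) > 0"
proof -
  have "\<bar>Re (r * cnj z)\<bar> \<le> norm r * norm z"
    using abs_Re_le_cmod [of "r * cnj z"] by (simp add: norm_mult)
  also have "\<dots> < norm z * norm z"
    using assms by (intro mult_strict_right_mono) (auto intro: le_less_trans)
  finally have *: "Re (r * cnj z) < Re z ^ 2 + Im z ^ 2"
    by (simp add: cmod_power2 flip: power2_eq_square)
  have "z \<noteq> r" using assms by auto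
  then have "norm (z - r) ^ 2 > 0" by simp
  then have "(Re z - Re r)\<^sup>2 + (Im z - Im r)\<^sup>2 > 0"
    by (simp only: cmod_power2 minus_complex.sel)
  moreover have "Re z * (Re z - Re r) + Im z * (Im z - Im r) > 0"
    using * by (simp add: algebra_simps power2_eq_square)
  ultimately show ?thesis
    by (simp add: Re_divide)
qed

lemma sum_mset_pos:
  fixes g :: "'a \<Rightarrow> real"
  assumes "A \<noteq> {#}" "\<And>x. x \<in># A \<Longrightarrow> g x > 0"
  shows "(\<Sum>x\<in>#A. g x) > 0"
  using assms
proof (induction A)
  case (add x A)
  then show ?case
    by (cases "A = {#}") (auto intro!: add_pos_pos)
qed simp

lemma Re_sum_mset: "Re (\<Sum>x\<in>#A. g x) = (\<Sum>x\<in>#A. Re (g x))"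
  by (induction A) auto

lemma pderiv_nonzero_outside_disk:
  fixes f :: "complex poly"
  assumes "degree f > 0" and roots: "\<And>r. poly f r = 0 \<Longrightarrow> norm r \<le> 1" and z: "norm z > 1"
  shows "poly (pderiv f) z \<noteq> 0"
proof
  assume 0: "poly (pderiv f) z = 0"
  have fz: "poly f z \<noteq> 0" using roots z by force
  have "f \<noteq> 0" using assms(1) by auto
  have "proots f \<noteq> {#}"
    using assms(1) size_proots_complex [of f] by auto
  moreover have "Re (z / (z - r)) > 0" if "r \<in># proots f" for r
    using that \<open>f \<noteq> 0\<close> roots [of r] z by (intro Re_divide_diff_pos) auto
  ultimately have "(\<Sum>r\<in>#proots f. Re (z / (z - r))) > 0"
    by (rule sum_mset_pos)
  moreover have "(\<Sum>r\<in>#proots f. z / (z - r)) = z * (\<Sum>r\<in>#proots f. 1 / (z - r))"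
    by (simp add: sum_mset_distrib_left)
  moreover have "(\<Sum>r\<in>#proots f. 1 / (z - r)) = 0"
    using poly_pderiv_eq_sum_proots [OF fz] 0 fz by simp
  ultimately show False
    by (simp flip: Re_sum_mset)
qed

section \<open>Self-inversive polynomials with critical points in the disk\<close>

text \<open>
  For \<open>norm r < 1\<close> this says that the Blaschke factor \<open>(z - r) / (1 - z * cnj r)\<close>, an automorphism
  of the disk, preserves the exterior as well.
\<close>
lemma norm_blaschke_factor_le:
  fixes z r :: complex
  assumes "norm r \<le> 1" "norm z \<ge> 1"
  shows "norm (1 - z * cnj r) \<le> norm (z - r)"
proof -
  have "complex_of_real ((norm z ^ 2 - 1) * (1 - norm r ^ 2))
      = of_real (norm (z - r) ^ 2 - norm (1 - z * cnj r) ^ 2)"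
    unfolding of_real_diff of_real_mult of_real_1 complex_norm_square
      complex_cnj_diff complex_cnj_mult complex_cnj_cnj complex_cnj_one
    by (simp only: ring_distribs mult_1_left mult_1_right mult_ac) simp
  then have "(norm z ^ 2 - 1) * (1 - norm r ^ 2) = norm (z - r) ^ 2 - norm (1 - z * cnj r) ^ 2"
    by (simp only: of_real_eq_iff)
  moreover have "(norm z ^ 2 - 1) * (1 - norm r ^ 2) \<ge> 0"
    using one_le_power [OF assms(2), of 2] power_le_one [OF norm_ge_zero assms(1), of 2]
    by (intro mult_nonneg_nonneg) simp_all
  ultimately have "norm (1 - z * cnj r) ^ 2 \<le> norm (z - r) ^ 2"
    by linarith
  then show ?thesis
    by (rule power2_le_imp_le) simp
qed

text \<open>
  To a factor \<open>z - r\<close> of \<open>g\<close> corresponds the factor \<open>1 - z * cnj r\<close> of the reversal, so the bound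
  holds factor by factor.
\<close>
lemma norm_conj_reversal_le:
  fixes g :: "complex poly"
  assumes roots: "\<And>r. poly g r = 0 \<Longrightarrow> norm r \<le> 1" and z: "norm z \<ge> 1"
  shows "norm (z ^ degree g * cnj (poly g (1 / cnj z))) \<le> norm (poly g z)"
proof (cases "g = 0")
  case False
  have z0: "z \<noteq> 0" using z by auto
  have prod: "norm (z ^ size A * cnj (\<Prod>r\<in>#A. 1 / cnj z - r)) \<le> norm (\<Prod>r\<in>#A. z - r)"
    if "\<forall>r\<in>#A. norm r \<le> 1" for A
    using that
  proof (induction A)
    case (add r A)
    have "z * cnj (1 / cnj z - r) = 1 - z * cnj r"
      using z0 by (simp add: right_diff_distrib)
    then have "norm (z * cnj (1 / cnj z - r)) \<le> norm (z - r)"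
      using norm_blaschke_factor_le [of r z] add.prems z by simp
    then have "norm (z * cnj (1 / cnj z - r)) * norm (z ^ size A * cnj (\<Prod>r\<in>#A. 1 / cnj z - r))
      \<le> norm (z - r) * norm (\<Prod>r\<in>#A. z - r)"
      using add by (intro mult_mono) auto
    then show ?case
      by (simp add: norm_mult mult_ac)
  qed simp
  have "norm (z ^ degree g * cnj (\<Prod>r\<in>#proots g. 1 / cnj z - r)) \<le> norm (\<Prod>r\<in>#proots g. z - r)"
    using prod [of "proots g"] roots False by (simp add: size_proots_complex)
  then have "norm (lead_coeff g) * norm (z ^ degree g * cnj (\<Prod>r\<in>#proots g. 1 / cnj z - r))
    \<le> norm (lead_coeff g) * norm (\<Prod>r\<in>#proots g. z - r)"
    by (rule mult_left_mono) simp
  then show ?thesis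
    unfolding poly_eq_prod_proots [of g] by (simp add: norm_mult mult_ac)
qed simp

lemma pderiv_map_poly_cnj: "pderiv (map_poly cnj p) = map_poly cnj (pderiv p)"
  by (rule poly_eqI) (simp add: coeff_pderiv coeff_map_poly)

text \<open>
  This is the derivative of the functional equation of \<open>f\<close>, multiplied by \<open>z\<close>.
\<close>
lemma self_inversive_pderiv:
  assumes "self_inversive f" "degree f > 0"
  obtains w where "norm w = 1"
    "\<And>z. z \<noteq> 0 \<Longrightarrow> of_nat (degree f) * poly f z
       = z * poly (pderiv f) z + w * (z ^ (degree f - 1) * cnj (poly (pderiv f) (1 / cnj z)))"
proof -
  let ?g = "map_poly cnj f"
  have "f \<noteq> 0" using assms(2) by auto
  then obtain w where w: "norm w = 1"
    and eq: "\<And>z. z \<noteq> 0 \<Longrightarrow> poly f z = w * z ^ degree f * poly ?g (1 / z)"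
    using assms(1) unfolding self_inversive_iff [OF \<open>f \<noteq> 0\<close>] by blast
  obtain m where m: "degree f = Suc m"
    using assms(2) by (cases "degree f") auto
  have "of_nat (degree f) * poly f z
      = z * poly (pderiv f) z + w * (z ^ (degree f - 1) * cnj (poly (pderiv f) (1 / cnj z)))"
    if z: "z \<noteq> 0" for z
  proof -
    have inv: "((\<lambda>z. 1 / z) has_field_derivative - (1 / z ^ 2)) (at z)"
      using z by (auto intro!: derivative_eq_intros simp: power2_eq_square)
    have "((\<lambda>z. poly ?g (1 / z)) has_field_derivative poly (pderiv ?g) (1 / z) * - (1 / z ^ 2)) (at z)"
      using DERIV_chain2 [OF poly_DERIV inv] .
    moreover have "((\<lambda>z. w * z ^ degree f) has_field_derivative w * (of_nat (Suc m) * z ^ m)) (at z)"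
      unfolding m
      using DERIV_cmult [OF DERIV_power [OF DERIV_ident, of "Suc m" z UNIV], of w]
      by (simp only: diff_Suc_1 mult_1 One_nat_def [symmetric])
    ultimately have "((\<lambda>z. w * z ^ degree f * poly ?g (1 / z)) has_field_derivative
        w * (of_nat (Suc m) * z ^ m) * poly ?g (1 / z)
        + poly (pderiv ?g) (1 / z) * - (1 / z ^ 2) * (w * z ^ degree f)) (at z)"
      by (rule DERIV_mult [rotated])
    then have "(poly f has_field_derivative
        w * (of_nat (Suc m) * z ^ m) * poly ?g (1 / z)
        + poly (pderiv ?g) (1 / z) * - (1 / z ^ 2) * (w * z ^ degree f)) (at z)"
      by (rule has_field_derivative_transform_within_open [where S = "- {0}"])
        (use z in \<open>auto intro: eq [symmetric] simp del: poly_map_poly_cnj\<close>)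
    then have "poly (pderiv f) z = w * (of_nat (Suc m) * z ^ m) * poly ?g (1 / z)
        + poly (pderiv ?g) (1 / z) * - (1 / z ^ 2) * (w * z ^ degree f)"
      by (rule DERIV_unique [OF poly_DERIV])
    then have "z * poly (pderiv f) z = of_nat (Suc m) * (w * z ^ Suc m * poly ?g (1 / z))
        - w * (z ^ m * poly (pderiv ?g) (1 / z))"
      using z unfolding m by (simp add: field_simps power2_eq_square)
    also have "w * z ^ Suc m * poly ?g (1 / z) = poly f z"
      using eq [OF z] by (simp only: m)
    finally show ?thesis
      by (simp add: m pderiv_map_poly_cnj)
  qed
  with w show thesis by (rule that)
qed

lemma self_inversive_root_inverse:
  assumes "self_inversive f" "poly f z = 0"
  shows "poly f (1 / cnj z) = 0"
proof -
  have f: "f \<noteq> 0" "image_mset (\<lambda>z. 1 / cnj z) (proots f) = proots f"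
    using assms(1) by (auto simp: self_inversive_def)
  have "z \<in># proots f" using f assms(2) by simp
  then have "1 / cnj z \<in># image_mset (\<lambda>z. 1 / cnj z) (proots f)"
    by (metis image_eqI set_image_mset)
  then show ?thesis using f by simp
qed

text \<open>
  At a zero of \<open>f\<close> the two summands of \<open>self_inversive_pderiv\<close> have equal moduli, whereas outside
  the disk the first one is larger.
\<close>
lemma self_inversive_nonzero_outside_disk:
  assumes f: "self_inversive f" "degree f > 0"
    and crit: "\<And>z. poly (pderiv f) z = 0 \<Longrightarrow> norm z \<le> 1" and z: "norm z > 1"
  shows "poly f z \<noteq> 0"
proof
  assume 0: "poly f z = 0"
  have "z \<noteq> 0" using z by auto
  obtain w where w: "norm w = 1" and
    "\<And>z. z \<noteq> 0 \<Longrightarrow> of_nat (degree f) * poly f z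
       = z * poly (pderiv f) z + w * (z ^ (degree f - 1) * cnj (poly (pderiv f) (1 / cnj z)))"
    using self_inversive_pderiv [OF f] by blast
  from this(2) [OF \<open>z \<noteq> 0\<close>]
  have "z * poly (pderiv f) z = - (w * (z ^ (degree f - 1) * cnj (poly (pderiv f) (1 / cnj z))))"
    unfolding 0 by (simp add: eq_neg_iff_add_eq_0)
  then have "norm (z * poly (pderiv f) z)
      = norm (w * (z ^ (degree f - 1) * cnj (poly (pderiv f) (1 / cnj z))))"
    by (simp only: norm_minus_cancel)
  also have "\<dots> = norm (z ^ degree (pderiv f) * cnj (poly (pderiv f) (1 / cnj z)))"
    by (simp only: norm_mult [of w] w degree_pderiv mult_1)
  also have "\<dots> \<le> norm (poly (pderiv f) z)"
    using z by (intro norm_conj_reversal_le crit) auto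
  finally have "norm z * norm (poly (pderiv f) z) \<le> 1 * norm (poly (pderiv f) z)"
    by (simp add: norm_mult)
  moreover have "poly (pderiv f) z \<noteq> 0" using crit z by force
  ultimately show False using z by simp
qed

lemma self_inversive_roots_on_circle:
  assumes f: "self_inversive f" "degree f > 0"
    and crit: "\<And>z. poly (pderiv f) z = 0 \<Longrightarrow> norm z \<le> 1" and 0: "poly f z = 0"
  shows "norm z = 1"
proof -
  have "z \<noteq> 0" using f 0 by (auto simp: self_inversive_def)
  have "norm z \<le> 1"
    using self_inversive_nonzero_outside_disk [OF f crit] 0 by force
  moreover have "norm (1 / cnj z) \<le> 1"
    using self_inversive_nonzero_outside_disk [OF f crit] self_inversive_root_inverse [OF f(1) 0]
    by force
  ultimately show ?thesis
    using \<open>z \<noteq> 0\<close> by (simp add: norm_divide field_simps)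
qed

section \<open>The Cayley transformation\<close>

lemma eval2_homogenization_eq_prod:
  "eval2 (homogenization f) u v = lead_coeff f * (\<Prod>r\<in>#proots f. u - r * v)"
proof (cases "v = 0")
  case True
  have "(\<Sum>i\<le>degree f. coeff f i * u ^ i * 0 ^ (degree f - i)) = lead_coeff f * u ^ degree f"
    by (subst sum.remove [of _ "degree f"]) (auto intro!: sum.neutral)
  then show ?thesis
    using True by (simp add: eval2_homogenization size_proots_complex)
next
  case False
  have "eval2 (homogenization f) u v = v ^ degree f * poly f (u / v)"
    unfolding eval2_homogenization poly_altdef sum_distrib_left
    using False by (intro sum.cong) (auto simp: power_diff power_divide)
  also have "\<dots> = lead_coeff f * (v ^ size (proots f) * (\<Prod>r\<in>#proots f. u / v - r))"
    by (simp add: poly_eq_prod_proots [of f] size_proots_complex)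
  also have "v ^ size A * (\<Prod>r\<in>#A. u / v - r) = (\<Prod>r\<in>#A. u - r * v)" for A
    using False by (induction A) (auto simp: field_simps)
  finally show ?thesis .
qed

lemma eval2_1 [simp]: "eval2 1 z y = 1"
  by (simp add: eval2_def)

lemma eval2_prod_list: "eval2 (prod_list Fs) z y = (\<Prod>F\<leftarrow>Fs. eval2 F z y)"
  by (induction Fs) auto

text \<open>
  Writing \<open>r = s ^ 2\<close> splits off the factor \<open>s\<close> and leaves \<open>cnj s - s\<close> and \<open>cnj s + s\<close> as the
  coefficients, which are imaginary and real.
\<close>
lemma cayley_linear_factor:
  fixes z y r :: complex
  assumes "norm r = 1"
  defines "s \<equiv> csqrt r"
  shows "(z - \<i> * y) - r * (z + \<i> * y)
    = (- 2 * \<i> * s) * (of_real (Im s) * z + of_real (Re s) * y)"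
proof -
  have r: "r = s * s"
    by (simp add: s_def flip: power2_eq_square)
  have "norm s ^ 2 = 1"
    using assms by (simp add: s_def flip: norm_power)
  then have "s * cnj s = 1"
    by (simp flip: complex_norm_square of_real_power)
  then have "(z - \<i> * y) - r * (z + \<i> * y) = s * cnj s * (z - \<i> * y) - s * s * (z + \<i> * y)"
    by (simp only: r mult_1)
  also have "\<dots> = s * ((cnj s - s) * z - \<i> * (cnj s + s) * y)"
    by (simp add: algebra_simps)
  also have "cnj s - s = - 2 * \<i> * of_real (Im s)"
    by (simp add: complex_eq_iff)
  also have "cnj s + s = 2 * of_real (Re s)"
    by (simp add: complex_eq_iff)
  finally show ?thesis
    by (simp add: algebra_simps)
qed

text \<open>
  The point \<open>((r + 1) / 2, (1 - r) / (2 * \<i>))\<close> is the one sent to \<open>(r, 1)\<close> by the substitution.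
\<close>
lemma norm_cayley_root:
  fixes r :: complex and a b :: real
  assumes "(a, b) \<noteq> (0, 0)" and "of_real a * ((r + 1) / 2) + of_real b * ((1 - r) / (2 * \<i>)) = 0"
  shows "norm r = 1"
proof -
  have "r * Complex (- b) a - Complex (- b) (- a)
      = 2 * \<i> * (of_real a * ((r + 1) / 2) + of_real b * ((1 - r) / (2 * \<i>)))"
    by (simp add: Complex_eq field_simps)
  then have "r * Complex (- b) a = Complex (- b) (- a)"
    using assms(2) by simp
  then have "norm r * norm (Complex (- b) a) = norm (Complex (- b) (- a))"
    by (metis norm_mult)
  moreover have "norm (Complex (- b) (- a)) = norm (Complex (- b) a)"
    by (simp add: cmod_def)
  moreover have "Complex (- b) a \<noteq> 0"
    using assms(1) by (auto simp: complex_eq_iff)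
  ultimately show ?thesis by simp
qed

lemma totally_real_cayley_iff:
  fixes f :: "complex poly" and M :: "complex^2^2"
  assumes "f \<noteq> 0" and M: "M = vector [vector [1, - \<i>], vector [1, \<i>]]"
  shows "totally_real (change_vars (homogenization f) M) \<longleftrightarrow> (\<forall>r. poly f r = 0 \<longrightarrow> norm r = 1)"
proof
  have eval: "eval2 (change_vars (homogenization f) M) z y
      = eval2 (homogenization f) (z - \<i> * y) (z + \<i> * y)" for z y :: complex
    by (simp add: eval2_change_vars M)
  {
    assume "totally_real (change_vars (homogenization f) M)"
    then obtain c and ls :: "(real \<times> real) list" where c: "c \<noteq> 0" and ls: "(0, 0) \<notin> set ls"
      and F: "change_vars (homogenization f) M
        = Cst c * (\<Prod>(a, b)\<leftarrow>ls. Cst (of_real a) * Z + Cst (of_real b) * Y)"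
      unfolding totally_real_def by blast
    show "\<forall>r. poly f r = 0 \<longrightarrow> norm r = 1"
    proof (intro allI impI)
      fix r assume r: "poly f r = 0"
      define z where "z = (r + 1) / 2"
      define y where "y = (1 - r) / (2 * \<i>)"
      have "z - \<i> * y = r" "z + \<i> * y = 1"
        by (simp_all add: z_def y_def field_simps)
      then have "eval2 (change_vars (homogenization f) M) z y = 0"
        unfolding eval using r \<open>f \<noteq> 0\<close> by (simp add: eval2_homogenization poly_altdef)
      then have "0 \<in> set (map (\<lambda>(a, b). of_real a * z + of_real b * y) ls)"
        unfolding F using c by (simp add: eval2_prod_list prod_list_zero_iff o_def case_prod_unfold)
      then obtain a b where "(a, b) \<in> set ls" "of_real a * z + of_real b * y = 0"
        by auto
      then show "norm r = 1"
        using ls by (intro norm_cayley_root [of a b]) (auto simp: z_def y_def)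
    qed
  }
  {
    assume roots: "\<forall>r. poly f r = 0 \<longrightarrow> norm r = 1"
    obtain rs where rs: "mset rs = proots f"
      using ex_mset by blast
    have norm_rs: "norm r = 1" if "r \<in> set rs" for r
    proof -
      have "r \<in># proots f" using that by (simp flip: rs)
      then show ?thesis using roots \<open>f \<noteq> 0\<close> by simp
    qed
    let ?c = "lead_coeff f * (\<Prod>r\<leftarrow>rs. - 2 * \<i> * csqrt r)"
    let ?ls = "map (\<lambda>r. (Im (csqrt r), Re (csqrt r))) rs"
    have "?c \<noteq> 0"
      using norm_rs \<open>f \<noteq> 0\<close> by (force simp: prod_list_zero_iff)
    moreover have "(0, 0) \<notin> set ?ls"
    proof
      assume "(0, 0) \<in> set ?ls"
      then obtain r where "r \<in> set rs" "csqrt r = 0"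
        by (auto simp: complex_eq_iff simp del: csqrt.sel csqrt_eq_0)
      then show False using norm_rs [of r] by simp
    qed
    moreover have "change_vars (homogenization f) M
        = Cst ?c * (\<Prod>(a, b)\<leftarrow>?ls. Cst (of_real a) * Z + Cst (of_real b) * Y)"
    proof (rule eval2_eqI)
      fix z y :: complex
      let ?l = "\<lambda>r. of_real (Im (csqrt r)) * z + of_real (Re (csqrt r)) * y"
      have "eval2 (change_vars (homogenization f) M) z y
          = lead_coeff f * (\<Prod>r\<leftarrow>rs. (z - \<i> * y) - r * (z + \<i> * y))"
        unfolding eval eval2_homogenization_eq_prod rs [symmetric]
        by (simp only: mset_map [symmetric] prod_mset_prod_list)
      also have "(\<Prod>r\<leftarrow>rs. (z - \<i> * y) - r * (z + \<i> * y)) = (\<Prod>r\<leftarrow>rs. (- 2 * \<i> * csqrt r) * ?l r)"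
        by (intro arg_cong [where f = prod_list] map_cong refl cayley_linear_factor norm_rs)
      also have "\<dots> = (\<Prod>r\<leftarrow>rs. - 2 * \<i> * csqrt r) * (\<Prod>r\<leftarrow>rs. ?l r)"
        by (induction rs) (simp_all only: list.map prod_list.Nil prod_list.Cons mult_1 mult_ac)
      finally show "eval2 (change_vars (homogenization f) M) z y
          = eval2 (Cst ?c * (\<Prod>(a, b)\<leftarrow>?ls. Cst (of_real a) * Z + Cst (of_real b) * Y)) z y"
        by (simp only: eval2_simps eval2_prod_list map_map o_def case_prod_conv mult.assoc)
    qed
    ultimately show "totally_real (change_vars (homogenization f) M)"
      unfolding totally_real_def by blast
  }
qed

theorem theorem4:
  fixes f :: "complex poly" and n :: nat and M :: "complex^2^2"
  assumes "self_inversive f" and "degree f = n" and "n \<ge> 2"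
    and "M = vector [vector [1, - \<i>], vector [1, \<i>]]"
  shows "((\<forall>z. poly f z = 0 \<longrightarrow> norm z = 1) \<longleftrightarrow>
            (\<forall>z. poly (pderiv f) z = 0 \<longrightarrow> norm z \<le> 1))
       \<and> ((\<forall>z. poly (pderiv f) z = 0 \<longrightarrow> norm z \<le> 1) \<longleftrightarrow>
            totally_real (change_vars (homogenization f) M))"
proof -
  have deg: "degree f > 0"
    using assms(2,3) by linarith
  then have "f \<noteq> 0"
    by auto
  have "(\<forall>z. poly f z = 0 \<longrightarrow> norm z = 1) \<longleftrightarrow> (\<forall>z. poly (pderiv f) z = 0 \<longrightarrow> norm z \<le> 1)"
  proof (intro iffI allI impI)
    fix z assume roots: "\<forall>z. poly f z = 0 \<longrightarrow> norm z = 1" and z: "poly (pderiv f) z = 0"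
    show "norm z \<le> 1"
    proof (rule ccontr)
      assume "\<not> norm z \<le> 1"
      then have "poly (pderiv f) z \<noteq> 0"
        by (intro pderiv_nonzero_outside_disk [OF deg]) (simp_all add: roots)
      then show False using z by contradiction
    qed
  next
    fix z assume crit: "\<forall>z. poly (pderiv f) z = 0 \<longrightarrow> norm z \<le> 1" and z: "poly f z = 0"
    show "norm z = 1"
      by (rule self_inversive_roots_on_circle [OF assms(1) deg _ z]) (simp add: crit)
  qed
  moreover have "totally_real (change_vars (homogenization f) M) \<longleftrightarrow> (\<forall>r. poly f r = 0 \<longrightarrow> norm r = 1)"
    by (rule totally_real_cayley_iff [OF \<open>f \<noteq> 0\<close> assms(4)])
  ultimately show ?thesis
    by (simp only: simp_thms)
qed

end
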